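(* Suppose that $\mathcal{A},\mathcal{B}\subseteq\mathbb{N}$. Then for each natural number $N$, one has $$\left(|\mathcal{B}|_0^N\,\left|\overline{\mathcal{A}+\mathcal{B}}\right|_{2N}^{3N}\right)^2\leqslant \left|\overline{\mathcal{A}}\right|_N^{3N}\,\Upsilon\left(\overline{\mathcal{A}+\mathcal{B}},\mathcal{B};N\right).$$
   Context: $\mathbb{N}$ denotes the set of positive integers. For $\mathcal{C}\subseteq\mathbb{N}$, $\overline{\mathcal{C}}=\mathbb{N}\setminus\mathcal{C}$. For non-negative integers $a,b$, $(\mathcal{C})_a^b=\mathcal{C}\cap(a,b]$ and $|\mathcal{C}|_a^b$ is the cardinality of $\mathcal{C}\cap(a,b]$. For $\mathcal{C},\mathcal{D}\subseteq\mathbb{N}$, $\mathcal{C}+\mathcal{D}=\{c+d: c\in\mathcal{C},\ d\in\mathcal{D}\}$. The quantity $\Upsilon(\mathcal{C},\mathcal{D};N)$ is the number of solutions of the equation $c_1-d_1=c_2-d_2$ with $c_1,c_2\in(\mathcal{C})_{2N}^{3N}$ and $d_1,d_2\in(\mathcal{D})_0^N$. *)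

theory Defs
  imports Main "HOL-Library.Set_Algebras"
begin

text \<open>
  The natural numbers of the paper are the positive integers. They are rendered as the set
  \<open>pos_nats\<close> inside type \<open>nat\<close>, and the complement of a set is taken relative to
  \<open>pos_nats\<close>, so that it never contains \<open>0\<close>. The sumset \<open>C + D\<close> is the one of
  \<^theory>\<open>HOL-Library.Set_Algebras\<close>.
\<close>

definition pos_nats :: "nat set" where
  "pos_nats = {0<..}"

definition pos_compl :: "nat set \<Rightarrow> nat set" where
  "pos_compl C = pos_nats - C"

definition slice :: "nat set \<Rightarrow> nat \<Rightarrow> nat \<Rightarrow> nat set" where
  "slice C a b = C \<inter> {a<..b}"

definition slice_card :: "nat set \<Rightarrow> nat \<Rightarrow> nat \<Rightarrow> nat" where
  "slice_card C a b = card (slice C a b)"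

text \<open>The differences are formed in \<open>int\<close> because subtraction on \<open>nat\<close> truncates.\<close>

definition Upsilon :: "nat set \<Rightarrow> nat set \<Rightarrow> nat \<Rightarrow> nat" where
  "Upsilon C D N = card {(c1, c2, d1, d2).
     c1 \<in> slice C (2 * N) (3 * N) \<and> c2 \<in> slice C (2 * N) (3 * N) \<and>
     d1 \<in> slice D 0 N \<and> d2 \<in> slice D 0 N \<and>
     int c1 - int d1 = int c2 - int d2}"

end

theory Submission
  imports Defs "HOL-Analysis.Convex"
begin

text \<open>
  If \<open>c\<close> avoids \<open>A + B\<close> and \<open>b \<in> B\<close> with \<open>b < c\<close>, then \<open>c - b\<close> avoids \<open>A\<close>. So subtraction maps
  the product of the slices of the complement of \<open>A + B\<close> and of \<open>B\<close> into the complement of \<open>A\<close>,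
  and \<open>\<Upsilon>\<close> counts the pairs with equal image; conclude by Cauchy--Schwarz over the fibres.
\<close>

text \<open>The fibres of \<open>f\<close> over \<open>M\<close> partition \<open>P\<close>, so
  \<open>card P\<close> is the sum of their sizes and the collision count is the sum of the squared
  sizes. Points of \<open>M\<close> outside the image give empty fibres, which add nothing to either
  sum.\<close>

lemma card_squared_le_card_mult_collisions:
  fixes f :: "'a \<Rightarrow> 'b"
  assumes "finite P" "finite M" "f ` P \<subseteq> M"
  shows "(card P)\<^sup>2 \<le> card M * card {(p, q). p \<in> P \<and> q \<in> P \<and> f p = f q}"
proof -
  define F where "F m = {p \<in> P. f p = m}" for m
  have fin: "finite (F m)" for m
    using assms(1) by (simp add: F_def)
  have "P = (\<Union>m\<in>M. F m)"
    using assms(3) by (auto simp: F_def)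
  moreover have "card (\<Union>m\<in>M. F m) = (\<Sum>m\<in>M. card (F m))"
    by (rule card_UN_disjoint) (use assms(2) fin in \<open>auto simp: F_def\<close>)
  ultimately have P: "card P = (\<Sum>m\<in>M. card (F m))"
    by simp
  have "{(p, q). p \<in> P \<and> q \<in> P \<and> f p = f q} = (\<Union>m\<in>M. F m \<times> F m)"
    using assms(3) by (auto simp: F_def)
  moreover have "card (\<Union>m\<in>M. F m \<times> F m) = (\<Sum>m\<in>M. card (F m \<times> F m))"
    by (rule card_UN_disjoint) (use assms(2) fin in \<open>auto simp: F_def\<close>)
  ultimately have Q: "card {(p, q). p \<in> P \<and> q \<in> P \<and> f p = f q} = (\<Sum>m\<in>M. (card (F m))\<^sup>2)"
    by (simp add: card_cartesian_product power2_eq_square)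
  \<comment> \<open>Cauchy--Schwarz against the constant 1, with the fibre sizes cast to
    reals.\<close>
  have "(\<Sum>m\<in>M. real (card (F m)))\<^sup>2 \<le> (\<Sum>m\<in>M. (real (card (F m)))\<^sup>2) * card M"
    by (rule sum_squared_le_sum_of_squares) 
  then have "real ((card P)\<^sup>2)
      \<le> real (card M * card {(p, q). p \<in> P \<and> q \<in> P \<and> f p = f q})"
    unfolding P Q by (simp add: mult.commute)
  then show ?thesis
    by (simp only: of_nat_le_iff)
qed

theorem theorem1p1:
  fixes A B :: "nat set" and N :: nat
  assumes "A \<subseteq> pos_nats" and "B \<subseteq> pos_nats" and "N \<in> pos_nats"
  shows "(slice_card B 0 N * slice_card (pos_compl (A + B)) (2 * N) (3 * N))\<^sup>2
    \<le> slice_card (pos_compl A) N (3 * N) * Upsilon (pos_compl (A + B)) B N"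
proof -
  define C where "C = slice (pos_compl (A + B)) (2 * N) (3 * N)"
  define D where "D = slice B 0 N"
  define M where "M = slice (pos_compl A) N (3 * N)"
  define f :: "nat \<times> nat \<Rightarrow> nat" where "f = (\<lambda>(c, d). c - d)"
  have fin: "finite C" "finite D" "finite M"
    by (simp_all add: C_def D_def M_def slice_def)
  \<comment> \<open>Here \<open>d \<le> N \<le> 2 * N < c\<close>, so the truncated subtraction in
    \<open>f\<close> is exact on \<open>C \<times> D\<close>.\<close>
  have less: "d < c" if "c \<in> C" "d \<in> D" for c d
    using that by (auto simp: C_def D_def slice_def)
  have image: "f ` (C \<times> D) \<subseteq> M"
  proof clarify
    fix c d assume cd: "c \<in> C" "d \<in> D"
    have "c - d \<notin> A"
    proof
      assume "c - d \<in> A"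
      then have "(c - d) + d \<in> A + B"
        using cd by (intro set_plus_intro) (auto simp: D_def slice_def)
      then show False
        using cd less[OF cd] by (auto simp: C_def slice_def pos_compl_def)
    qed
    \<comment> \<open>From \<open>2 * N < c\<close> and \<open>d \<le> N\<close> follows
      \<open>N < c - d\<close>, which gives both the lower end of the slice and positivity; the
      upper end comes from \<open>c \<le> 3 * N\<close>.\<close>
    then show "f (c, d) \<in> M"
      using cd by (auto simp: f_def C_def D_def M_def slice_def pos_compl_def pos_nats_def)
  qed
  let ?S = "{(p, q). p \<in> C \<times> D \<and> q \<in> C \<times> D \<and> f p = f q}"
  let ?T = "{(c1, c2, d1, d2). c1 \<in> C \<and> c2 \<in> C \<and> d1 \<in> D \<and> d2 \<in> D \<and>
    int c1 - int d1 = int c2 - int d2}"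
  have diff: "c1 - d1 = c2 - d2 \<longleftrightarrow> int c1 - int d1 = int c2 - int d2"
    if "c1 \<in> C" "d1 \<in> D" "c2 \<in> C" "d2 \<in> D" for c1 d1 c2 d2
    using less[OF that(1,2)] less[OF that(3,4)] by linarith
  \<comment> \<open>Only the coordinates are regrouped: a collision is a pair of pairs, while
    \<open>Upsilon\<close> lists both elements of \<open>C\<close> first; \<open>diff\<close>
    matches the equations over \<open>nat\<close> and \<open>int\<close>.\<close>
  have "bij_betw (\<lambda>((c1, d1), (c2, d2)). (c1, c2, d1, d2)) ?S ?T"
    by (rule bij_betw_byWitness[where f' = "\<lambda>(c1, c2, d1, d2). ((c1, d1), (c2, d2))"])
       (auto simp: f_def diff)
  then have "card ?S = Upsilon (pos_compl (A + B)) B N"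
    by (simp add: bij_betw_same_card Upsilon_def C_def D_def)
  moreover have "(card (C \<times> D))\<^sup>2 \<le> card M * card ?S"
    using fin image by (intro card_squared_le_card_mult_collisions) auto
  ultimately show ?thesis
    by (simp add: card_cartesian_product slice_card_def C_def D_def M_def mult.commute)
qed

end
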